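(* Let $p\in\mathcal{H}_1$ be such that $$\left|\frac{zp'(z)}{p^2(z)}\right|<\frac{\tanh 1}{2\cosh 1}\approx 0.246\ldots\qquad(z\in\mathbb{D}).$$ Then $p(z)\prec\cosh\sqrt z$.
   Context: $\mathbb{D}=\{z\in\mathbb{C}:|z|<1\}$. $\mathcal{H}_1$ is the class of analytic functions on $\mathbb{D}$ of the form $p(z)=1+a_1z+a_2z^2+\cdots$. For analytic functions $f,g$ on $\mathbb{D}$, $f\prec g$ means that $f(z)=g(w(z))$ for some analytic $w:\mathbb{D}\to\mathbb{D}$ with $w(0)=0$. The function $\cosh\sqrt z$ denotes the analytic function $\sum_{n=0}^\infty z^n/(2n)!$. *)

theory Defs
  imports "HOL-Complex_Analysis.Complex_Analysis"
begin

definition class_H1 :: "(complex \<Rightarrow> complex) set"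
  where "class_H1 = {p. p holomorphic_on ball 0 1 \<and> p 0 = 1}"

lemma class_H1_iff_power_series:
  "p \<in> class_H1 \<longleftrightarrow> (\<exists>a. a 0 = 1 \<and> (\<forall>z\<in>ball 0 1. (\<lambda>n. a n * z ^ n) sums p z))"
proof
  assume p: "p \<in> class_H1"
  have "(\<lambda>n. (deriv ^^ n) p 0 / fact n * z ^ n) sums p z" if "z \<in> ball 0 1" for z
    using holomorphic_power_series[of p 0 1 z] p that by (simp add: class_H1_def)
  moreover have "(deriv ^^ 0) p 0 / fact 0 = 1"
    using p by (simp add: class_H1_def)
  ultimately show "\<exists>a. a 0 = 1 \<and> (\<forall>z\<in>ball 0 1. (\<lambda>n. a n * z ^ n) sums p z)"
    by (intro exI[of _ "\<lambda>n. (deriv ^^ n) p 0 / fact n"] conjI ballI)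
next
  assume "\<exists>a. a 0 = 1 \<and> (\<forall>z\<in>ball 0 1. (\<lambda>n. a n * z ^ n) sums p z)"
  then obtain a where a0: "a 0 = 1"
    and a: "\<And>z. z \<in> ball 0 1 \<Longrightarrow> (\<lambda>n. a n * z ^ n) sums p z"
    by blast
  have "p holomorphic_on ball 0 1"
    by (rule power_series_holomorphic[where a = a]) (use a in simp)
  moreover have "p 0 = 1"
    using sums_unique2[OF a[of 0] powser_sums_zero[of a]] a0 by simp
  ultimately show "p \<in> class_H1"
    by (simp add: class_H1_def)
qed

definition subordinate :: "(complex \<Rightarrow> complex) \<Rightarrow> (complex \<Rightarrow> complex) \<Rightarrow> bool"
  where "subordinate f g \<longleftrightarrow>
    (\<exists>w. w holomorphic_on ball 0 1 \<and> w ` ball 0 1 \<subseteq> ball 0 1 \<and> w 0 = 0 \<and>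
      (\<forall>z\<in>ball 0 1. f z = g (w z)))"

definition cosh_sqrt :: "complex \<Rightarrow> complex"
  where "cosh_sqrt z = (\<Sum>n. z ^ n / fact (2 * n))"

lemma cosh_sqrt_sums: "(\<lambda>n. z ^ n / fact (2 * n)) sums cosh (csqrt z)"
proof -
  let ?f = "\<lambda>n. if even n then csqrt z ^ n /\<^sub>R fact n else 0"
  have "?f sums cosh (csqrt z)"
    by (rule cosh_converges)
  moreover have "strict_mono (\<lambda>n::nat. 2 * n)"
    by (simp add: strict_mono_def)
  moreover have "?f n = 0" if "n \<notin> range (\<lambda>n::nat. 2 * n)" for n
    using that by (metis evenE rangeI)
  ultimately have "(\<lambda>n. ?f (2 * n)) sums cosh (csqrt z)"
    using sums_mono_reindex[of "\<lambda>n::nat. 2 * n" ?f "cosh (csqrt z)"] by blast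
  moreover have "?f (2 * n) = z ^ n / fact (2 * n)" for n
  proof -
    have "csqrt z ^ (2 * n) = z ^ n"
      by (simp only: power_mult power2_csqrt)
    then show ?thesis
      by (simp add: scaleR_conv_of_real divide_inverse)
  qed
  ultimately show ?thesis
    by simp
qed

lemma cosh_sqrt_eq: "cosh_sqrt z = cosh (csqrt z)"
  unfolding cosh_sqrt_def using cosh_sqrt_sums by (rule sums_unique[symmetric])

end

theory Submission
  imports Defs
begin

text \<open>With \<open>g = 1 / p\<close> the hypothesis reads \<open>\<bar>z g'(z)\<bar> < \<beta>\<close>, so Schwarz's lemma gives
  \<open>\<bar>g'\<bar> \<le> \<beta>\<close> and hence \<open>\<bar>g - 1\<bar> < \<beta>\<close> on the disc. Since \<open>\<beta> \<le> 1/4\<close>, this yields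
  \<open>\<bar>p - 1\<bar> < 1/3\<close>. On the other hand, \<open>cosh \<surd>w = 1 + w/2 + R(w)\<close> where \<open>R\<close> is Lipschitz with
  constant \<open>1/6\<close> on the unit disc, so \<open>cosh \<surd>w\<close> is univalent there and, by Banach's fixed point
  theorem, its image contains the disc of radius \<open>1/3\<close> about \<open>1\<close>.\<close>

text \<open>Since \<open>tanh x / cosh x = sinh x / cosh x ^ 2\<close>, the claim is
  \<open>2 * sinh x \<le> 1 + sinh x ^ 2\<close>, a perfect square.\<close>

lemma tanh_div_cosh_le:
  fixes x :: real
  shows "tanh x / (2 * cosh x) \<le> 1 / 4"
proof -
  have "0 \<le> (sinh x - 1)\<^sup>2" by simp
  then have "2 * sinh x \<le> (cosh x)\<^sup>2"
    by (simp add: cosh_square_eq power2_diff)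
  then show ?thesis
    using cosh_real_pos[of x] by (simp add: tanh_def field_simps power2_eq_square)
qed

text \<open>At \<open>k = 0\<close> the value is \<open>2 / 4! = 1 / 12\<close>, and each further
  term is at most half the previous one. The geometric majorant sums to \<open>1 / 6\<close>, the
  Lipschitz constant of the remainder.\<close>

lemma fact_even_bound: "real (k + 2) / fact (2 * (k + 2)) \<le> 1 / 12 * (1 / 2) ^ k"
proof (induction k)
  case 0
  then show ?case by (simp add: fact_numeral)
next
  case (Suc k)
  have "real (Suc k + 2) / fact (2 * (Suc k + 2))
      = real (k + 2) / fact (2 * (k + 2)) * (real (k + 3) / (real (k + 2) * (real (2 * k + 6) * real (2 * k + 5))))"
    by (simp add: divide_simps) (simp add: algebra_simps)
  also have "\<dots> \<le> (1 / 12 * (1 / 2) ^ k) * (1 / 2)"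
  proof (intro mult_mono Suc.IH)
    have "real (k + 3) / (real (k + 2) * (real (2 * k + 6) * real (2 * k + 5)))
        = 1 / 2 * (1 / (real (k + 2) * real (2 * k + 5)))"
      by (simp add: divide_simps) (simp add: algebra_simps)
    also have "\<dots> \<le> 1 / 2 * 1"
      by (intro mult_left_mono) (auto simp: divide_simps algebra_simps)
    finally show "real (k + 3) / (real (k + 2) * (real (2 * k + 6) * real (2 * k + 5))) \<le> 1 / 2"
      by simp
  qed auto
  finally show ?case by simp
qed

lemma cosh_sqrt_series: "(\<lambda>n. w ^ n / fact (2 * n)) sums cosh_sqrt w"
  using cosh_sqrt_sums[of w] by (simp add: cosh_sqrt_eq)

lemma holomorphic_cosh_sqrt: "cosh_sqrt holomorphic_on ball 0 r"
  by (rule power_series_holomorphic[where a = "\<lambda>n. 1 / fact (2 * n)"])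
    (use cosh_sqrt_series in simp)

lemma cosh_sqrt_0: "cosh_sqrt 0 = 1"
  by (simp add: cosh_sqrt_eq)

text \<open>On the closed unit disc \<open>w ^ n\<close> is Lipschitz with constant
  \<open>n\<close>, so the terms from degree two on contribute at most the sum of
  \<open>n / (2 * n)!\<close>.\<close>

lemma cosh_sqrt_remainder_lipschitz:
  assumes "norm w \<le> 1" "norm v \<le> 1"
  shows "norm ((cosh_sqrt w - w / 2) - (cosh_sqrt v - v / 2)) \<le> norm (w - v) / 6"
proof -
  let ?a = "\<lambda>n. (w ^ n - v ^ n) / fact (2 * n)"
  let ?b = "\<lambda>k. norm (w - v) * (1 / 12 * (1 / 2) ^ k) :: real"
  have "?a sums (cosh_sqrt w - cosh_sqrt v)"
    using sums_diff[OF cosh_sqrt_series cosh_sqrt_series, of w v] by (simp add: diff_divide_distrib)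
  \<comment> \<open>Of the two terms split off, the constant one cancels and the linear one is
    \<open>(w - v) / 2\<close>.\<close>
  then have "(\<lambda>k. ?a (k + 2)) sums (cosh_sqrt w - cosh_sqrt v - (\<Sum>i<2. ?a i))"
    by (rule sums_split_initial_segment)
  moreover have "(\<Sum>i<2. ?a i) = w / 2 - v / 2"
    by (simp add: numeral_2_eq_2 diff_divide_distrib)
  moreover have "cosh_sqrt w - cosh_sqrt v - (w / 2 - v / 2)
      = (cosh_sqrt w - w / 2) - (cosh_sqrt v - v / 2)"
    by simp
  ultimately have a: "(\<lambda>k. ?a (k + 2)) sums ((cosh_sqrt w - w / 2) - (cosh_sqrt v - v / 2))"
    by (simp only:)
  have "(\<lambda>k. (1 / 2 :: real) ^ k) sums 2"
    using geometric_sums[of "1 / 2 :: real"] by simp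
  then have b: "?b sums (norm (w - v) * (1 / 12 * 2))"
    by (intro sums_mult)
  have le: "norm (?a (k + 2)) \<le> ?b k" for k
  proof -
    have "norm (w ^ (k + 2) - v ^ (k + 2)) \<le> real (k + 2) * norm (w - v)"
      using norm_power_diff assms by blast
    then have "norm (?a (k + 2)) \<le> real (k + 2) * norm (w - v) / fact (2 * (k + 2))"
      unfolding norm_divide norm_fact by (intro divide_right_mono) simp_all
    also have "\<dots> = norm (w - v) * (real (k + 2) / fact (2 * (k + 2)))" by simp
    also have "\<dots> \<le> ?b k"
      by (intro mult_left_mono fact_even_bound) simp
    finally show ?thesis .
  qed
  have "norm (\<Sum>k. ?a (k + 2)) \<le> (\<Sum>k. ?b k)"
    using le by (intro norm_suminf_le sums_summable[OF b])
  then show ?thesis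
    using sums_unique[OF a] sums_unique[OF b] by simp
qed

text \<open>The linear part separates points at rate \<open>1 / 2\<close>, which the remainder, of
  rate \<open>1 / 6\<close>, cannot compensate.\<close>

lemma inj_on_cosh_sqrt: "inj_on cosh_sqrt (cball 0 1)"
proof (rule inj_onI)
  fix w v :: complex
  assume "w \<in> cball 0 1" "v \<in> cball 0 1" and eq: "cosh_sqrt w = cosh_sqrt v"
  then have "norm ((cosh_sqrt w - w / 2) - (cosh_sqrt v - v / 2)) \<le> norm (w - v) / 6"
    by (intro cosh_sqrt_remainder_lipschitz) simp_all
  moreover have "(cosh_sqrt w - w / 2) - (cosh_sqrt v - v / 2) = - ((w - v) / 2)"
    by (simp add: eq field_simps)
  ultimately have "norm (w - v) / 2 \<le> norm (w - v) / 6"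
    by (simp add: norm_divide)
  then have "norm (w - v) \<le> 0" by linarith
  then show "w = v" by simp
qed

lemma ball_subset_image_cosh_sqrt: "ball 1 (1 / 3) \<subseteq> cosh_sqrt ` ball 0 1"
proof
  fix u :: complex
  assume "u \<in> ball 1 (1 / 3)"
  then have u: "norm (u - 1) < 1 / 3"
    by (simp add: dist_norm norm_minus_commute)
  \<comment> \<open>Solving \<open>cosh_sqrt w = u\<close> for the linear term \<open>w / 2\<close>
    turns it into \<open>T w = w\<close>; doubling the remainder makes \<open>T\<close> a
    contraction with constant \<open>1 / 3\<close>.\<close>
  define T where "T w = 2 * (u - (cosh_sqrt w - w / 2))" for w
  have lip: "norm (T w - T v) \<le> 1 / 3 * norm (w - v)" if "norm w \<le> 1" "norm v \<le> 1" for w v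
  proof -
    have "T w - T v = - (2 * ((cosh_sqrt w - w / 2) - (cosh_sqrt v - v / 2)))"
      by (simp add: T_def algebra_simps)
    then have "norm (T w - T v) = 2 * norm ((cosh_sqrt w - w / 2) - (cosh_sqrt v - v / 2))"
      by (simp only: norm_minus_cancel norm_mult norm_numeral)
    then show ?thesis
      using cosh_sqrt_remainder_lipschitz[OF that] by linarith
  qed
  have bound: "norm (T w) < 1" if "norm w \<le> 1" for w
  proof -
    have "T 0 = 2 * (u - 1)" by (simp add: T_def cosh_sqrt_0)
    then have "norm (T 0) = 2 * norm (u - 1)" by (simp only: norm_mult norm_numeral)
    moreover have "norm (T w) \<le> norm (T w - T 0) + norm (T 0)"
      by (metis diff_add_cancel norm_triangle_ineq)
    moreover have "norm (T w - T 0) \<le> 1 / 3 * norm w"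
      using lip[of w 0] that by simp
    ultimately show ?thesis using u that by linarith
  qed
  have "\<exists>!w\<in>cball 0 1. T w = w"
  proof (rule Banach_fix[where c = "1 / 3"])
    show "T ` cball 0 1 \<subseteq> cball 0 1"
      using bound by (auto simp: less_imp_le)
  qed (use lip in \<open>auto simp: dist_norm compact_imp_complete\<close>)
  then obtain w where w: "norm w \<le> 1" "T w = w" by auto
  \<comment> \<open>The fixed point was found in the closed disc; as a value of \<open>T\<close> it
    lies in the open one.\<close>
  then have "norm w < 1" using bound by metis
  moreover have "cosh_sqrt w = u"
    using w(2) by (simp add: T_def algebra_simps)
  ultimately show "u \<in> cosh_sqrt ` ball 0 1" by force
qed

text \<open>Division by zero makes a bound on \<open>z p'(z) / p(z)\<^sup>2\<close> vacuous at the zeros of \<open>p\<close>. Zeros are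
  excluded because at one of order \<open>n\<close> the quotient has a pole of order \<open>n + 1\<close>.\<close>

lemma bounded_deriv_quotient_imp_nonzero:
  fixes p :: "complex \<Rightarrow> complex"
  assumes hol: "p holomorphic_on S" and S: "open S" "connected S"
    and nz: "0 \<in> S" "p 0 \<noteq> 0"
    and bound: "\<And>z. z \<in> S \<Longrightarrow> norm (z * deriv p z / (p z)\<^sup>2) \<le> B"
    and \<xi>: "\<xi> \<in> S"
  shows "p \<xi> \<noteq> 0"
proof
  assume p0: "p \<xi> = 0"
  have "\<not> p constant_on S"
    using p0 nz \<xi> by (metis constant_on_def)
  then obtain h r n where n: "0 < n" and r: "0 < r" "ball \<xi> r \<subseteq> S"
    and h: "h holomorphic_on ball \<xi> r"
    and p: "\<And>w. w \<in> ball \<xi> r \<Longrightarrow> p w = (w - \<xi>) ^ n * h w"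
    and h0: "\<And>w. w \<in> ball \<xi> r \<Longrightarrow> h w \<noteq> 0"
    using holomorphic_factor_zero_nonconstant[OF hol S \<xi> p0] by (metis (no_types, lifting))
  \<comment> \<open>With \<open>p z = (z - \<xi>) ^ n * h z\<close>, the bound on
    \<open>z * deriv p z\<close> becomes \<open>norm (l z) \<le> m z\<close> once the common factor
    of order \<open>n - 1\<close> is cancelled.\<close>
  define l where "l z = z * (of_nat n * h z + (z - \<xi>) * deriv h z)" for z
  define m where "m z = B * (norm (z - \<xi>) ^ (n + 1) * (norm (h z))\<^sup>2)" for z
  have "norm (l z) \<le> m z" if z: "z \<in> ball \<xi> r" "z \<noteq> \<xi>" for z
  proof -
    have "((\<lambda>w. (w - \<xi>) ^ n * h w) has_field_derivative
        (z - \<xi>) ^ n * deriv h z + of_nat n * (z - \<xi>) ^ (n - 1) * h z) (at z)"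
      by (rule derivative_eq_intros refl holomorphic_derivI[OF h open_ball z(1)] | simp)+
    then have "(p has_field_derivative
        (z - \<xi>) ^ n * deriv h z + of_nat n * (z - \<xi>) ^ (n - 1) * h z) (at z)"
      by (rule has_field_derivative_transform_within_open[OF _ open_ball z(1)]) (simp add: p)
    then have "deriv p z = (z - \<xi>) ^ n * deriv h z + of_nat n * (z - \<xi>) ^ (n - 1) * h z"
      by (rule DERIV_imp_deriv)
    moreover have "(z - \<xi>) ^ n = (z - \<xi>) ^ (n - 1) * (z - \<xi>)"
      using n by (cases n) simp_all
    ultimately have *: "z * deriv p z = (z - \<xi>) ^ (n - 1) * l z"
      unfolding l_def by (simp only: ring_distribs ac_simps)
    have pz: "p z \<noteq> 0" using p h0 z by simp
    have "norm (z * deriv p z) \<le> B * (norm (p z))\<^sup>2"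
      using bound[of z] z(1) r(2) pz by (auto simp: norm_divide norm_power divide_simps)
    also have "\<dots> = norm (z - \<xi>) ^ (n - 1) * m z"
      using n by (cases n) (auto simp: p[OF z(1)] m_def norm_mult norm_power power2_eq_square)
    finally have "norm (z - \<xi>) ^ (n - 1) * norm (l z) \<le> norm (z - \<xi>) ^ (n - 1) * m z"
      by (simp add: * norm_mult norm_power)
    then show ?thesis using z(2) by simp
  qed
  then have le: "\<forall>\<^sub>F z in at \<xi>. norm (l z) \<le> m z"
    using r(1) by (auto simp: eventually_at dist_commute intro!: exI[of _ r])
  have \<xi>r: "\<xi> \<in> ball \<xi> r" using r by simp
  have ch: "isCont h \<xi>" "isCont (deriv h) \<xi>"
    using h holomorphic_deriv[OF h open_ball] \<xi>r
    by (meson continuous_on_eq_continuous_at holomorphic_on_imp_continuous_on open_ball)+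
  have "isCont (\<lambda>z. norm (l z)) \<xi>" "isCont m \<xi>"
    unfolding l_def m_def using ch by (intro continuous_intros; simp)+
  then have "norm (l \<xi>) \<le> m \<xi>"
    using le by (intro tendsto_le[OF _ _ _ le]) (auto simp: isCont_def)
  \<comment> \<open>In the limit \<open>m \<xi> = 0\<close>, while \<open>l \<xi>\<close> is
    \<open>\<xi> * of_nat n * h \<xi>\<close> with \<open>n\<close> and \<open>h \<xi>\<close>
    nonzero.\<close>
  then have "\<xi> = 0"
    using n h0[OF \<xi>r] by (simp add: l_def m_def)
  then show False using p0 nz by simp
qed

text \<open>Schwarz's lemma for \<open>z * deriv g z / B\<close>: its growth bound settles
  \<open>z \<noteq> 0\<close> after dividing by \<open>z\<close>, its derivative bound settles the
  origin.\<close>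

lemma norm_deriv_le_if_norm_mult_deriv_less:
  assumes g: "g holomorphic_on ball 0 1"
    and bound: "\<And>z. norm z < 1 \<Longrightarrow> norm (z * deriv g z) < B"
    and z: "norm z < 1"
  shows "norm (deriv g z) \<le> B"
proof -
  have B: "B > 0" using bound[of 0] by simp
  define f where "f z = z * deriv g z / of_real B" for z
  have g': "deriv g holomorphic_on ball 0 1"
    by (rule holomorphic_deriv[OF g open_ball])
  have f: "f holomorphic_on ball 0 1"
    unfolding f_def using B by (intro holomorphic_on_divide holomorphic_on_mult g' holomorphic_on_ident
        holomorphic_on_const) auto
  have f1: "norm (f w) < 1" if "norm w < 1" for w
    using bound[OF that] B by (simp add: f_def norm_divide)
  have f0: "f 0 = 0" by (simp add: f_def)
  note schwarz = Schwarz_Lemma[OF f f0 f1]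
  show ?thesis
  proof (cases "z = 0")
    case True
    have "(f has_field_derivative deriv g 0 / of_real B) (at 0)"
      unfolding f_def using B
      by (auto intro!: derivative_eq_intros holomorphic_derivI[OF g' open_ball])
    then have "deriv f 0 = deriv g 0 / of_real B" by (rule DERIV_imp_deriv)
    then show ?thesis
      using schwarz(2)[of z] z B True by (simp add: norm_divide)
  next
    case False
    then show ?thesis
      using schwarz(1)[of z] z B by (simp add: f_def norm_mult norm_divide divide_simps)
  qed
qed

theorem theorem4p7:
  fixes p :: "complex \<Rightarrow> complex"
  assumes "p \<in> class_H1"
    and "\<forall>z\<in>ball 0 1. norm (z * deriv p z / (p z)\<^sup>2) < tanh (1::real) / (2 * cosh (1::real))"
  shows "subordinate p cosh_sqrt"
proof -
  have p: "p holomorphic_on ball 0 1" "p 0 = 1"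
    using assms(1) by (auto simp: class_H1_def)
  have bound: "norm (z * deriv p z / (p z)\<^sup>2) < 1 / 4" if "norm z < 1" for z
  proof -
    have "norm (z * deriv p z / (p z)\<^sup>2) < tanh (1::real) / (2 * cosh 1)"
      using assms(2) that by simp
    also have "\<dots> \<le> 1 / 4" by (rule tanh_div_cosh_le)
    finally show ?thesis .
  qed
  have nz: "p z \<noteq> 0" if "norm z < 1" for z
    by (rule bounded_deriv_quotient_imp_nonzero[OF p(1), where B = "1 / 4"])
      (use p bound that in \<open>auto simp: less_imp_le\<close>)
  define g where "g z = 1 / p z" for z
  have g: "g holomorphic_on ball 0 1"
    unfolding g_def using nz p by (intro holomorphic_intros) auto
  have g': "norm (z * deriv g z) < 1 / 4" if "norm z < 1" for z
  proof -
    have "(g has_field_derivative - deriv p z / (p z)\<^sup>2) (at z)"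
      unfolding g_def using nz[OF that] that
      by (auto intro!: derivative_eq_intros holomorphic_derivI[OF p(1) open_ball]
          simp: power2_eq_square)
    then have "deriv g z = - deriv p z / (p z)\<^sup>2" by (rule DERIV_imp_deriv)
    then show ?thesis using bound[OF that] by (simp add: norm_divide norm_mult)
  qed
  have p_ball: "p z \<in> ball 1 (1 / 3)" if z: "norm z < 1" for z
  proof -
    have "norm (g z - g 0) \<le> 1 / 4 * norm (z - 0)"
    proof (rule field_differentiable_bound[of "ball 0 1"])
      fix w :: complex
      assume w: "w \<in> ball 0 1"
      show "(g has_field_derivative deriv g w) (at w within ball 0 1)"
        using holomorphic_derivI[OF g open_ball w] .
      show "norm (deriv g w) \<le> 1 / 4"
        using w norm_deriv_le_if_norm_mult_deriv_less[OF g g'] by simp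
    qed (use z in auto)
    then have "norm (g z - 1) < 1 / 4"
      using z p by (simp add: g_def)
    moreover have "g z - 1 = (1 - p z) / p z"
      using nz[OF z] by (simp add: g_def field_simps)
    ultimately have "norm (1 - p z) < 1 / 4 * norm (p z)"
      using nz[OF z] by (simp add: norm_divide divide_simps)
    \<comment> \<open>Writing \<open>d\<close> for \<open>norm (1 - p z)\<close>, the two estimates
      give \<open>d < (1 + d) / 4\<close>, that is \<open>d < 1 / 3\<close>.\<close>
    moreover have "norm (p z) \<le> 1 + norm (1 - p z)"
      using norm_triangle_sub[of "p z" 1] by (simp add: norm_minus_commute)
    ultimately show ?thesis by (simp add: dist_norm)
  qed
  have inj: "inj_on cosh_sqrt (ball 0 1)"
    by (rule inj_on_subset[OF inj_on_cosh_sqrt]) auto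
  obtain F where F: "F holomorphic_on cosh_sqrt ` ball 0 1"
    and F_inv: "\<And>z. z \<in> ball 0 1 \<Longrightarrow> F (cosh_sqrt z) = z"
    using holomorphic_has_inverse[OF holomorphic_cosh_sqrt open_ball inj] by metis
  have img: "p z \<in> cosh_sqrt ` ball 0 1" if "z \<in> ball 0 1" for z
    using p_ball ball_subset_image_cosh_sqrt that by auto
  show ?thesis
    unfolding subordinate_def
  \<comment> \<open>The Schwarz function is \<open>p\<close> followed by the holomorphic inverse of
    \<open>cosh_sqrt\<close>, defined along \<open>p\<close> because the values of \<open>p\<close>
    lie in the image.\<close>
  proof (intro exI[of _ "F \<circ> p"] conjI ballI)
    show "F \<circ> p holomorphic_on ball 0 1"
      using img by (intro holomorphic_on_compose_gen[OF p(1) F]) auto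
    show "(F \<circ> p) ` ball 0 1 \<subseteq> ball 0 1"
      using img F_inv by force
    show "(F \<circ> p) 0 = 0"
      using F_inv[of 0] p by (simp add: cosh_sqrt_0)
    show "p z = cosh_sqrt ((F \<circ> p) z)" if "z \<in> ball 0 1" for z
      using img[OF that] F_inv by auto
  qed
qed

end
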